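(* Let $n \geq 3$, let $X$ be a real $n$-dimensional normed space and let $N \geq 0$ be the number of facets of the unit ball of $X$. Then the number of $(n-1)$-dimensional subspaces $Y \subset X$ such that $\lambda(Y, X) = 2 - \frac{2}{n}$ is not greater than $\binom{N}{n}$.
   Context: All normed spaces are real. For a subspace $Y$ of a normed space $X$, a projection from $X$ onto $Y$ is a bounded linear operator $P: X \to Y$ with $P|_Y = \mathrm{Id}_Y$; the relative projection constant $\lambda(Y,X)$ is the infimum of $\|P\|$ over all projections $P$ from $X$ onto $Y$. A face of a convex body in an $n$-dimensional space is its intersection with some supporting hyperplane; a face is a facet if it is $(n-1)$-dimensional, i.e. not contained in an affine subspace of dimension $n-2$. Here $\binom{N}{n}$ denotes the number (cardinality) of $n$-element subsets of the set of facets. *)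

theory Defs
  imports "HOL-Analysis.Analysis" "HOL-Library.Ramsey" "HOL-Library.Equipollence"
begin

text \<open>
  The ambient normed space is the whole type \<open>'a\<close>. Finite dimensionality is imposed by
  \<open>dim (UNIV :: 'a set) = n\<close> with \<open>n > 0\<close>, since \<open>dim\<close> is 0 on infinite-dimensional spaces.
\<close>

definition is_projection_onto :: "('a::real_normed_vector \<Rightarrow> 'a) \<Rightarrow> 'a set \<Rightarrow> bool" where
  "is_projection_onto P Y \<longleftrightarrow> bounded_linear P \<and> range P \<subseteq> Y \<and> (\<forall>y\<in>Y. P y = y)"

text \<open>
  The infimum is taken in the reals, so the value is meaningful only if \<open>Y\<close> admits a bounded
  projection; this holds for every subspace of a finite-dimensional space.
\<close>

definition rel_projection_const :: "'a::real_normed_vector set \<Rightarrow> real" where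
  "rel_projection_const Y = Inf {onorm P | P. is_projection_onto P Y}"

definition supporting_hyperplane :: "'a::real_normed_vector set \<Rightarrow> 'a set \<Rightarrow> bool" where
  "supporting_hyperplane K H \<longleftrightarrow>
     (\<exists>f c. bounded_linear f \<and> f \<noteq> (\<lambda>x. 0) \<and> H = {x. f x = (c::real)} \<and>
            (\<forall>x\<in>K. f x \<le> c) \<and> K \<inter> H \<noteq> {})"

text \<open>
  The library's \<open>facet_of\<close> needs a Euclidean space, and its faces are not defined
  by supporting hyperplanes.
\<close>

definition is_face :: "'a::real_normed_vector set \<Rightarrow> 'a set \<Rightarrow> bool" where
  "is_face K F \<longleftrightarrow> (\<exists>H. supporting_hyperplane K H \<and> F = K \<inter> H)"

text \<open>
  An affine subspace of dimension \<open>d\<close> is a translate of a \<open>d\<close>-dimensional linear subspace.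
  The subtraction below is on natural numbers: the definition is intended for spaces
  of dimension at least 2.
\<close>

definition is_facet :: "'a::real_normed_vector set \<Rightarrow> 'a set \<Rightarrow> bool" where
  "is_facet K F \<longleftrightarrow> is_face K F \<and>
     \<not> (\<exists>a V. subspace V \<and> dim V = dim (UNIV :: 'a set) - 2 \<and> F \<subseteq> (\<lambda>v. a + v) ` V)"

end

theory Submission
  imports Defs
begin

text \<open>
  Let \<open>Y\<close> be the kernel of \<open>f\<close>. The projections onto \<open>Y\<close> are the maps sending \<open>x\<close> to \<open>x - f x *\<^sub>R w\<close>
  with \<open>f w = 1\<close>. By compactness one of them has minimal norm \<open>\<mu>\<close>, say the one along \<open>w\<^sub>0\<close>
  (\<open>minimal_projection\<close>). Its minimality is certified by duality: there are at most \<open>n\<close> vectors \<open>x i\<close>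
  in the unit ball and as many functionals \<open>g i\<close> in the dual ball, with positive weights \<open>\<beta> i\<close> of sum \<open>1\<close>,
  such that each pair attains the norm, \<open>g i (x i) - f (x i) * g i w\<^sub>0 = \<mu>\<close>, and \<open>\<Sum> \<beta> i * g i\<close> is a
  multiple of \<open>f\<close> (\<open>saddle_point_few_pairs\<close>, where separation gives the certificate and
  Caratheodory's theorem bounds the number of pairs).

  Evaluating this multiple of \<open>f\<close> at the \<open>x i\<close> and using only \<open>\<bar>g j (x i)\<bar> \<le> 1\<close>, a convexity
  argument gives \<open>\<mu> \<le> 2 - 2 / n\<close>. The case of equality is rigid (\<open>extremal_weights\<close>): there are
  exactly \<open>n\<close> pairs, all weights are \<open>1 / n\<close>, \<open>g i (x i) = 1\<close>, and \<open>g j (x i) = -1\<close> for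
  \<open>i \<noteq> j\<close>.

  For \<open>n \<ge> 3\<close> the matrix of these values is invertible, so the \<open>x i\<close> form a basis. The functional \<open>g i\<close>
  equals \<open>1\<close> at the points \<open>x i\<close> and \<open>- x j\<close> of the unit ball, which also span the space, so
  \<open>{g i = 1}\<close> cuts out a facet \<open>F i\<close>. As \<open>f\<close> is a multiple of \<open>\<Sum> g i\<close> and each \<open>g i\<close> is
  determined by \<open>F i\<close>, the \<open>n\<close> facets determine \<open>Y\<close>. Assigning them to \<open>Y\<close> is the desired injection.

  Duality and compactness take place in a Euclidean space \<open>'e\<close>, to which the normed space is linearly isomorphic
  (\<open>euclidean_coordinates\<close>); functionals are then vectors acting by the inner product.
\<close>

section \<open>Bohnenblust's inequality for weights and its equality case\<close>

text \<open>
  Taylor expansion with exact remainder, at \<open>c\<close>, of the convex function \<open>b / (1 - 2 * b)\<close>. The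
  remainder vanishes only at \<open>b = c\<close>, which is what forces equal weights below.
\<close>

lemma tangent_gap:
  fixes b s :: real
  assumes "s = 1 - 2 * c" "0 < s" "2 * b < 1"
  shows "b / (1 - 2 * b) = c / s + (b - c) / s\<^sup>2 + 2 * (b - c)\<^sup>2 / ((1 - 2 * b) * s\<^sup>2)"
proof -
  have "1 - 2 * b \<noteq> 0" "1 - 2 * c \<noteq> 0" using assms by auto
  then show ?thesis unfolding assms(1)
    by (simp add: divide_simps power2_eq_square) algebra
qed

text \<open>
  This is the inequality of Bohnenblust together with its equality case. Write \<open>s = 1 - 2 / n\<close>.
  Isolating the diagonal term in the balance equation for index \<open>i\<close>, and bounding the other entries
  below by \<open>-1\<close>, gives \<open>s * T \<le> t i * (1 - 2 * \<beta> i)\<close>. Averaging with the weights \<open>\<beta>\<close> gives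
  \<open>s * (\<Sum>i\<in>I. \<beta> i / (1 - 2 * \<beta> i)) \<le> 1\<close>, whereas convexity and \<open>card I \<le> n\<close> bound
  the same quantity from below by \<open>1\<close>. So there is equality everywhere: all weights are \<open>1 / n\<close>, all \<open>t i\<close>
  equal \<open>T\<close>, and no entry can differ from its extreme value.
\<close>

lemma extremal_weights:
  fixes \<beta> t h :: "'i \<Rightarrow> real" and a :: "'i \<Rightarrow> 'i \<Rightarrow> real"
  assumes n: "n \<ge> 3" and fin: "finite I" and card: "card I \<le> n"
    and pos: "\<And>i. i \<in> I \<Longrightarrow> \<beta> i > 0" and sum1: "sum \<beta> I = 1"
    and h: "\<And>i. i \<in> I \<Longrightarrow> h i > 0"
    and bnd: "\<And>i j. i \<in> I \<Longrightarrow> j \<in> I \<Longrightarrow> \<bar>a j i\<bar> \<le> 1"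
    and diag: "\<And>i. i \<in> I \<Longrightarrow> a i i + h i * t i = 2 - 2 / real n"
    and T: "T = (\<Sum>j\<in>I. \<beta> j * t j)"
    and bal: "\<And>i. i \<in> I \<Longrightarrow> (\<Sum>j\<in>I. \<beta> j * a j i) = - (T * h i)"
  shows "card I = n" "T > 0" "\<And>i. i \<in> I \<Longrightarrow> \<beta> i = 1 / real n" "\<And>i. i \<in> I \<Longrightarrow> a i i = 1"
    "\<And>i j. i \<in> I \<Longrightarrow> j \<in> I \<Longrightarrow> i \<noteq> j \<Longrightarrow> a j i = -1"
proof -
  define s where "s = 1 - 2 / real n"
  have s: "0 < s" and sn: "real n * s = real n - 2" using n by (auto simp: s_def field_simps)
  have diag': "a i i = 1 + s - h i * t i" if "i \<in> I" for i using diag[OF that] by (simp add: s_def)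
  have ht: "h i * t i \<ge> s" if "i \<in> I" for i using diag'[OF that] bnd[OF that that] by linarith
  have tpos: "t i > 0" if "i \<in> I" for i
    using ht[OF that] h[OF that] s by (meson less_le_trans zero_less_mult_pos)
  have ne: "I \<noteq> {}" using sum1 by auto
  show T0: "T > 0" unfolding T by (rule sum_pos) (use fin ne pos tpos in auto)
  have bt: "\<beta> i * t i \<le> T" if "i \<in> I" for i
    unfolding T by (rule member_le_sum) (use that fin pos tpos in \<open>auto intro!: mult_nonneg_nonneg less_imp_le\<close>)
  have rest: "(\<Sum>j\<in>I - {i}. \<beta> j * a j i) \<ge> - (1 - \<beta> i)" if "i \<in> I" for i
  proof -
    have "(\<Sum>j\<in>I - {i}. \<beta> j * (- 1)) \<le> (\<Sum>j\<in>I - {i}. \<beta> j * a j i)"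
    proof (rule sum_mono)
      fix j assume j: "j \<in> I - {i}"
      then have "- 1 \<le> a j i" using bnd[OF that, of j] by (simp add: abs_le_iff)
      then show "\<beta> j * (- 1) \<le> \<beta> j * a j i" using pos[of j] j by (intro mult_left_mono) auto
    qed
    moreover have "(\<Sum>j\<in>I - {i}. \<beta> j) = 1 - \<beta> i" using sum1 fin that by (simp add: sum_diff1)
    ultimately show ?thesis by (simp add: sum_negf)
  qed
  have split: "(\<Sum>j\<in>I. \<beta> j * a j i) = \<beta> i * a i i + (\<Sum>j\<in>I - {i}. \<beta> j * a j i)" if "i \<in> I" for i
    using fin that by (rule sum.remove)
  have key: "h i * (T - \<beta> i * t i) \<le> 1 - \<beta> i * (2 + s)" if "i \<in> I" for i
  proof -
    have "\<beta> i * a i i - (1 - \<beta> i) \<le> - (T * h i)" using rest[OF that] split[OF that] bal[OF that] by linarith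
    then show ?thesis unfolding diag'[OF that] by (simp add: algebra_simps)
  qed
  have key2: "s * T \<le> t i * (1 - 2 * \<beta> i)" if "i \<in> I" for i
  proof -
    have "s * (T - \<beta> i * t i) \<le> (h i * t i) * (T - \<beta> i * t i)"
      by (rule mult_right_mono) (use ht bt that in auto)
    also have "\<dots> = t i * (h i * (T - \<beta> i * t i))" by simp
    also have "\<dots> \<le> t i * (1 - \<beta> i * (2 + s))"
      by (rule mult_left_mono) (use key tpos that in \<open>auto intro: less_imp_le\<close>)
    finally show ?thesis by (simp add: algebra_simps)
  qed
  have b2: "2 * \<beta> i < 1" if "i \<in> I" for i
  proof -
    have "0 < t i * (1 - 2 * \<beta> i)" using key2[OF that] s T0 by (meson less_le_trans mult_pos_pos)
    then show ?thesis using tpos[OF that] by (simp add: zero_less_mult_iff)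
  qed
  \<comment> \<open>the remainder of the tangent line bound at the uniform weight \<open>1 / n\<close>\<close>
  define gap where "gap i = 2 * (\<beta> i - 1 / real n)\<^sup>2 / ((1 - 2 * \<beta> i) * s\<^sup>2)" for i
  have gap0: "gap i \<ge> 0" if "i \<in> I" for i unfolding gap_def using b2[OF that] by auto
  have up: "s * (\<Sum>i\<in>I. \<beta> i / (1 - 2 * \<beta> i)) \<le> 1"
  proof -
    have "s * T * (\<beta> i / (1 - 2 * \<beta> i)) \<le> \<beta> i * t i" if "i \<in> I" for i
    proof -
      define d where "d = 1 - 2 * \<beta> i"
      have d: "d > 0" using b2[OF that] by (simp add: d_def)
      have "s * T * (\<beta> i / d) \<le> t i * d * (\<beta> i / d)"
        by (rule mult_right_mono) (use key2[OF that] pos[OF that] d in \<open>auto simp: d_def\<close>)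
      also have "\<dots> = \<beta> i * t i" using d by simp
      finally show ?thesis by (simp add: d_def)
    qed
    then have "(\<Sum>i\<in>I. s * T * (\<beta> i / (1 - 2 * \<beta> i))) \<le> T" unfolding T by (rule sum_mono)
    then have "T * (s * (\<Sum>i\<in>I. \<beta> i / (1 - 2 * \<beta> i))) \<le> T * 1"
      by (simp add: sum_distrib_left mult_ac)
    then show ?thesis using T0 by (simp only: mult_le_cancel_left_pos)
  qed
  have "(\<Sum>i\<in>I. \<beta> i / (1 - 2 * \<beta> i)) = (\<Sum>i\<in>I. (1 / real n) / s + (\<beta> i - 1 / real n) / s\<^sup>2 + gap i)"
    by (rule sum.cong[OF refl]) (use tangent_gap[of s "1 / real n"] s b2 in \<open>simp add: gap_def s_def\<close>)
  also have "\<dots> = real (card I) / real n / s + (1 - real (card I) / real n) / s\<^sup>2 + sum gap I"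
    by (simp add: sum.distrib sum_divide_distrib[symmetric] sum_subtractf sum1)
  finally have S: "(\<Sum>i\<in>I. \<beta> i / (1 - 2 * \<beta> i)) = real (card I) / real n / s + (1 - real (card I) / real n) / s\<^sup>2 + sum gap I" .
  \<comment> \<open>the tangent line bound is exactly \<open>1\<close> when \<open>q = 1\<close> and exceeds \<open>1\<close> when \<open>q < 1\<close>\<close>
  define q where "q = real (card I) / real n"
  have q: "q \<le> 1" using card n by (simp add: q_def)
  have q2: "s * (\<Sum>i\<in>I. \<beta> i / (1 - 2 * \<beta> i)) = q + (1 - q) / s + s * sum gap I"
    unfolding S q_def[symmetric] using s by (simp add: field_simps power2_eq_square)
  have s1: "s < 1" using n by (simp add: s_def)
  have "1 / s > 1" using s s1 by simp
  have "(1 - q) * 1 \<le> (1 - q) * (1 / s)"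
    by (rule mult_left_mono) (use \<open>1 / s > 1\<close> q in auto)
  moreover have gs: "sum gap I \<ge> 0" by (rule sum_nonneg) (rule gap0)
  moreover from this have "s * sum gap I \<ge> 0" using s by simp
  ultimately have g: "s * sum gap I \<le> 0" and qs: "(1 - q) / s \<le> 1 - q"
    using up q2 by auto
  have "q = 1"
  proof (rule ccontr)
    assume "q \<noteq> 1" then have "1 - q > 0" using q by simp
    then have "(1 - q) * 1 < (1 - q) * (1 / s)"
      by (rule mult_strict_left_mono[OF \<open>1 / s > 1\<close>])
    then show False using qs by simp
  qed
  then show cI: "card I = n" using n by (simp add: q_def field_simps)
  have "sum gap I = 0" using g gs s by (simp add: mult_le_0_iff)
  then have "gap i = 0" if "i \<in> I" for i using sum_nonneg_eq_0_iff[OF fin gap0] that by auto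
  then show bn: "\<beta> i = 1 / real n" if "i \<in> I" for i using b2[OF that] that s by (fastforce simp: gap_def)
  have tT: "t i \<ge> T" if "i \<in> I" for i using key2[OF that] s bn[OF that] by (simp add: s_def mult.commute)
  have "(\<Sum>i\<in>I. t i - T) = 0"
  proof -
    have "T = (\<Sum>j\<in>I. t j) / real n" unfolding T sum_divide_distrib by (rule sum.cong) (auto simp: bn)
    then show ?thesis using n cI by (simp add: sum_subtractf field_simps)
  qed
  then have tT: "t i = T" if "i \<in> I" for i
    using sum_nonneg_eq_0_iff[OF fin, of "\<lambda>i. t i - T"] tT that by auto
  have hT: "h i * T = s" if "i \<in> I" for i
  proof -
    have "(h i * T) * (1 - 1 / real n) \<le> s * (1 - 1 / real n)"
      using key[OF that] n unfolding bn[OF that] tT[OF that] s_def by (simp add: field_simps power2_eq_square)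
    then have "h i * T \<le> s" using n by (simp add: mult_le_cancel_right)
    then show ?thesis using ht[OF that] tT[OF that] by simp
  qed
  show a1: "a i i = 1" if "i \<in> I" for i using diag'[OF that] hT[OF that] tT[OF that] by simp
  show "a j i = -1" if "i \<in> I" "j \<in> I" "i \<noteq> j" for i j
  proof -
    have "(\<Sum>j\<in>I. \<beta> j * a j i) = (\<Sum>j\<in>I. a j i) / real n"
      unfolding sum_divide_distrib by (rule sum.cong) (auto simp: bn)
    then have "(\<Sum>j\<in>I. a j i) / real n = - s"
      using bal[OF that(1)] hT[OF that(1)] by (simp add: mult.commute)
    then have "(\<Sum>j\<in>I. a j i) = - (real n * s)"
      using n by (simp add: field_simps)
    then have "(\<Sum>j\<in>I - {i}. a j i) = 1 - real n"
      using sum.remove[OF fin that(1), of "\<lambda>j. a j i"] a1[OF that(1)] sn by simp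
    then have "(\<Sum>j\<in>I - {i}. a j i + 1) = 0"
      using cI fin that(1) n by (simp add: sum.distrib of_nat_diff)
    moreover have "a j i + 1 \<ge> 0" if "j \<in> I - {i}" for j using bnd[of i j] \<open>i \<in> I\<close> that by (auto simp: abs_le_iff)
    ultimately have "a j i + 1 = 0"
      using sum_nonneg_eq_0_iff[of "I - {i}" "\<lambda>j. a j i + 1"] fin that by auto
    then show ?thesis by simp
  qed
qed

section \<open>Duality for minimal projections\<close>

text \<open>
  For \<open>f \<bullet> w = 1\<close> the number \<open>y \<bullet> u - (f \<bullet> u) * (y \<bullet> w)\<close> is the value of the functional \<open>y\<close>
  at the image of \<open>u\<close> under the projection onto the kernel of \<open>f\<close> along \<open>w\<close>. If no \<open>w\<close> makes all
  these values smaller than \<open>\<mu>\<close>, linear programming duality yields a finitely supported probability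
  \<open>p\<close> on pairs \<open>(u, y)\<close> for which the average of the values is at least \<open>\<mu>\<close> for every \<open>w\<close>: the
  average of \<open>(f \<bullet> u) *\<^sub>R y\<close> is the multiple \<open>c\<close> of \<open>f\<close>, so \<open>w\<close> contributes only the constant
  \<open>c\<close>. Each pair is recorded as the point \<open>((f \<bullet> u) *\<^sub>R y, y \<bullet> u)\<close>, which makes the values affine
  in it. Were there no such \<open>p\<close>, a hyperplane separating the convex hull \<open>M\<close> of these points from the
  half-plane \<open>Z\<close> of admissible averages would be the graph of a better direction \<open>w\<close>.
\<close>

lemma saddle_point_certificate:
  fixes K Kd :: "'e::euclidean_space set"
  assumes K: "compact K" "K \<noteq> {}" "\<forall>u\<in>K. - u \<in> K" and Kd: "compact Kd" "Kd \<noteq> {}"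
    and fw: "f \<bullet> w\<^sub>0 = 1"
    and low: "\<forall>w c. f \<bullet> w = 1 \<longrightarrow> (\<forall>u\<in>K. \<forall>y\<in>Kd. y \<bullet> u - (f \<bullet> u) * (y \<bullet> w) \<le> c) \<longrightarrow> \<mu> \<le> c"
  obtains S p c where "finite S" "S \<subseteq> (\<lambda>(u, y). ((f \<bullet> u) *\<^sub>R y, y \<bullet> u)) ` (K \<times> Kd)"
    "\<forall>z\<in>S. p z \<ge> 0" "sum p S = 1"
    "(\<Sum>z\<in>S. p z *\<^sub>R fst z) = c *\<^sub>R f" "(\<Sum>z\<in>S. p z * snd z) \<ge> \<mu> + c"
proof -
  define \<Phi> :: "'e \<times> 'e \<Rightarrow> 'e \<times> real" where "\<Phi> = (\<lambda>(u, y). ((f \<bullet> u) *\<^sub>R y, y \<bullet> u))"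
  define M where "M = convex hull (\<Phi> ` (K \<times> Kd))"
  define Z :: "('e \<times> real) set" where
    "Z = {z. fst z = (w\<^sub>0 \<bullet> fst z) *\<^sub>R f \<and> \<mu> \<le> snd z - w\<^sub>0 \<bullet> fst z}"
  have in_Z: "(c *\<^sub>R f, s) \<in> Z \<longleftrightarrow> \<mu> \<le> s - c" for c s
    using fw by (simp add: Z_def inner_commute)
  have "continuous_on (K \<times> Kd) \<Phi>"
    unfolding \<Phi>_def case_prod_unfold by (intro continuous_intros)
  then have cM: "compact M"
    unfolding M_def using K Kd by (intro compact_convex_hull compact_continuous_image compact_Times)
  have neM: "M \<noteq> {}" using K Kd by (simp add: M_def)
  have clZ: "closed Z"
    unfolding Z_def by (intro closed_Collect_conj closed_Collect_eq closed_Collect_le continuous_intros)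
  have cvZ: "convex Z"
  proof (rule convexI)
    fix x y :: "'e \<times> real" and a b :: real
    assume x: "x \<in> Z" and y: "y \<in> Z" and ab: "0 \<le> a" "0 \<le> b" "a + b = 1"
    let ?z = "a *\<^sub>R x + b *\<^sub>R y"
    have "fst ?z = a *\<^sub>R ((w\<^sub>0 \<bullet> fst x) *\<^sub>R f) + b *\<^sub>R ((w\<^sub>0 \<bullet> fst y) *\<^sub>R f)"
      using x y by (simp add: Z_def)
    also have "\<dots> = (w\<^sub>0 \<bullet> fst ?z) *\<^sub>R f" by (simp add: inner_add_right algebra_simps)
    finally have 1: "fst ?z = (w\<^sub>0 \<bullet> fst ?z) *\<^sub>R f" .
    have "\<mu> = a * \<mu> + b * \<mu>" using ab by (metis distrib_right mult_1)
    also have "\<dots> \<le> a * (snd x - w\<^sub>0 \<bullet> fst x) + b * (snd y - w\<^sub>0 \<bullet> fst y)"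
      using x y ab by (intro add_mono mult_left_mono) (auto simp: Z_def)
    also have "\<dots> = snd ?z - w\<^sub>0 \<bullet> fst ?z" by (simp add: inner_add_right algebra_simps)
    finally show "?z \<in> Z" using 1 by (simp add: Z_def)
  qed
  have "M \<inter> Z \<noteq> {}"
  proof
    assume "M \<inter> Z = {}"
    then obtain a b where aM: "\<And>m. m \<in> M \<Longrightarrow> a \<bullet> m < b" and aZ: "\<And>z. z \<in> Z \<Longrightarrow> b < a \<bullet> z"
      using separating_hyperplane_compact_closed[OF _ cM neM cvZ clZ] M_def by (metis convex_convex_hull)
    obtain v r where a: "a = (v, r)" by (cases a)
    \<comment> \<open>the separating functional is bounded below on the half-plane, hence constant along its boundary line\<close>
    have Zkj: "b < k * (v \<bullet> f + r) + r * \<mu> + r * j" if "j \<ge> 0" for k j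
      using aZ[of "(k *\<^sub>R f, \<mu> + k + j)"] that by (simp add: in_Z a algebra_simps)
    have vf: "v \<bullet> f + r = 0"
      using Zkj[of 0 "(b - r * \<mu> - 1) / (v \<bullet> f + r)"] by (cases "v \<bullet> f + r = 0") auto
    have b: "b < r * \<mu>" using Zkj[of 0 0] by simp
    have "r \<ge> 0"
    proof (rule ccontr)
      assume r: "\<not> r \<ge> 0"
      then have "(b - r * \<mu>) / r \<ge> 0" using b by (simp add: divide_nonpos_neg)
      from Zkj[OF this, of 0] r show False by simp
    qed
    have Mb: "(f \<bullet> u) * (v \<bullet> y) + r * (y \<bullet> u) < b" if "u \<in> K" "y \<in> Kd" for u y
      using aM[of "\<Phi> (u, y)"] that hull_inc[of "\<Phi> (u, y)" "\<Phi> ` (K \<times> Kd)" convex]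
      by (force simp: M_def a \<Phi>_def)
    show False
    \<comment> \<open>a vertical hyperplane is excluded by the symmetry of \<open>K\<close>, any other one has a direction \<open>w\<close> as its slope\<close>
    proof (cases "r = 0")
      case True
      obtain u y where uy: "u \<in> K" "y \<in> Kd" using K Kd by auto
      show False using Mb[OF uy] Mb[OF bspec[OF K(3) uy(1)] uy(2)] True b by simp
    next
      case False
      then have r: "r > 0" using \<open>r \<ge> 0\<close> by simp
      define w where "w = (- 1 / r) *\<^sub>R v"
      have "f \<bullet> w = 1" using vf r by (simp add: w_def inner_commute field_simps)
      moreover have "y \<bullet> u - (f \<bullet> u) * (y \<bullet> w) \<le> b / r" if "u \<in> K" "y \<in> Kd" for u y
      proof -
        have "y \<bullet> u - (f \<bullet> u) * (y \<bullet> w) = ((f \<bullet> u) * (v \<bullet> y) + r * (y \<bullet> u)) / r"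
          using r by (simp add: w_def inner_commute field_simps)
        also have "\<dots> \<le> b / r"
          using Mb[OF that] r by (intro divide_right_mono) auto
        finally show ?thesis .
      qed
      ultimately have "\<mu> \<le> b / r" using low by blast
      then show False using b r by (simp add: field_simps)
    qed
  qed
  then obtain m where m: "m \<in> M" "m \<in> Z" by auto
  from m(1) obtain S p where S: "finite S" "S \<subseteq> \<Phi> ` (K \<times> Kd)" "\<forall>z\<in>S. p z \<ge> 0" "sum p S = 1"
    and eq: "(\<Sum>z\<in>S. p z *\<^sub>R z) = m"
    unfolding M_def convex_hull_explicit by auto
  show ?thesis
  proof (rule that[of S p "w\<^sub>0 \<bullet> fst m"])
    show "(\<Sum>z\<in>S. p z *\<^sub>R fst z) = (w\<^sub>0 \<bullet> fst m) *\<^sub>R f"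
      using m(2) unfolding eq[symmetric] by (simp add: Z_def fst_sum)
    show "(\<Sum>z\<in>S. p z * snd z) \<ge> \<mu> + w\<^sub>0 \<bullet> fst m"
      using m(2) unfolding eq[symmetric] by (simp add: Z_def snd_sum)
  qed (use S in \<open>auto simp: \<Phi>_def\<close>)
qed

text \<open>
  A hyperplane has one dimension less than the space, so the number of points in Caratheodory's theorem
  drops from \<open>DIM('e) + 1\<close> to \<open>DIM('e)\<close>.
\<close>

lemma caratheodory_in_hyperplane:
  fixes D :: "'e::euclidean_space set"
  assumes "0 \<in> convex hull D" "D \<subseteq> {x. w \<bullet> x = 0}" "w \<noteq> 0"
  obtains S p where "finite S" "S \<subseteq> D" "card S \<le> DIM('e)" "\<forall>z\<in>S. p z > 0" "sum p S = 1"
    "(\<Sum>z\<in>S. p z *\<^sub>R z) = 0"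
proof -
  have "aff_dim D \<le> int (DIM('e)) - 1"
    using aff_dim_subset[OF assms(2)] aff_dim_hyperplane[OF assms(3), of 0] by simp
  moreover obtain S p where S: "finite S" "S \<subseteq> D" "int (card S) \<le> aff_dim D + 1"
    "\<forall>z\<in>S. p z \<ge> 0" "sum p S = 1" "(\<Sum>z\<in>S. p z *\<^sub>R z) = 0"
    using assms(1) unfolding convex_hull_caratheodory_aff_dim by auto
  ultimately have card: "card S \<le> DIM('e)" by linarith
  let ?S = "{z \<in> S. p z \<noteq> 0}"
  show ?thesis
  proof (rule that[of ?S p])
    show "card ?S \<le> DIM('e)"
      using card_mono[OF S(1), of ?S] card by auto
    have "sum p ?S = sum p S"
      by (rule sum.mono_neutral_left[OF S(1)]) auto
    then show "sum p ?S = 1" using S(5) by (rule trans)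
    have "(\<Sum>z\<in>?S. p z *\<^sub>R z) = (\<Sum>z\<in>S. p z *\<^sub>R z)"
      by (rule sum.mono_neutral_left[OF S(1)]) auto
    then show "(\<Sum>z\<in>?S. p z *\<^sub>R z) = 0" using S(6) by (rule trans)
  qed (use S in \<open>auto simp: less_le\<close>)
qed

text \<open>
  An optimal \<open>w\<^sub>0\<close> turns the certificate into norming pairs: an average of numbers at most \<open>\<mu>\<close> is at
  least \<open>\<mu>\<close>, so the pairs of positive weight attain \<open>\<mu>\<close>. The map \<open>L\<close> projects along \<open>f\<close>
  onto the hyperplane orthogonal to \<open>w\<^sub>0\<close>; there the certificate says that \<open>0\<close> lies in a convex hull,
  and Caratheodory's theorem reduces the number of pairs to the dimension. The exact bound
  \<open>DIM('e)\<close> matters, since the extremal configuration has exactly that many pairs.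
\<close>

lemma saddle_point_few_pairs:
  fixes K Kd :: "'e::euclidean_space set"
  assumes K: "compact K" "K \<noteq> {}" "\<forall>u\<in>K. - u \<in> K" and Kd: "compact Kd" "Kd \<noteq> {}"
    and fw: "f \<bullet> w\<^sub>0 = 1"
    and up: "\<And>u y. u \<in> K \<Longrightarrow> y \<in> Kd \<Longrightarrow> y \<bullet> u - (f \<bullet> u) * (y \<bullet> w\<^sub>0) \<le> \<mu>"
    and low: "\<forall>w c. f \<bullet> w = 1 \<longrightarrow> (\<forall>u\<in>K. \<forall>y\<in>Kd. y \<bullet> u - (f \<bullet> u) * (y \<bullet> w) \<le> c) \<longrightarrow> \<mu> \<le> c"
  obtains I :: "'e set" and \<alpha> u y c where "finite I" "card I \<le> DIM('e)"
    "\<forall>i\<in>I. \<alpha> i > 0" "sum \<alpha> I = 1" "\<forall>i\<in>I. u i \<in> K" "\<forall>i\<in>I. y i \<in> Kd"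
    "\<forall>i\<in>I. y i \<bullet> u i - (f \<bullet> u i) * (y i \<bullet> w\<^sub>0) = \<mu>"
    "(\<Sum>i\<in>I. (\<alpha> i * (f \<bullet> u i)) *\<^sub>R y i) = c *\<^sub>R f"
proof -
  obtain S p c where S: "finite S" "S \<subseteq> (\<lambda>(u, y). ((f \<bullet> u) *\<^sub>R y, y \<bullet> u)) ` (K \<times> Kd)"
    "\<forall>z\<in>S. p z \<ge> 0" "sum p S = 1"
    "(\<Sum>z\<in>S. p z *\<^sub>R fst z) = c *\<^sub>R f" "(\<Sum>z\<in>S. p z * snd z) \<ge> \<mu> + c"
    by (rule saddle_point_certificate[OF K Kd fw low])
  \<comment> \<open>the value of a pair at \<open>w\<^sub>0\<close>, in terms of its recorded point\<close>
  define l where "l z = snd z - w\<^sub>0 \<bullet> fst z" for z :: "'e \<times> real"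
  define L where "L x = x - (w\<^sub>0 \<bullet> x) *\<^sub>R f" for x
  have wL: "w\<^sub>0 \<bullet> L x = 0" for x
    using fw by (simp add: L_def inner_diff_right inner_commute)
  have linL: "linear L"
    by (rule linearI) (simp_all add: L_def inner_add_right algebra_simps)
  have l_le: "l z \<le> \<mu>" if "z \<in> S" for z
    using subsetD[OF S(2) that] up by (auto simp: l_def inner_commute)
  have "(\<Sum>z\<in>S. p z * l z) = (\<Sum>z\<in>S. p z * snd z) - w\<^sub>0 \<bullet> (\<Sum>z\<in>S. p z *\<^sub>R fst z)"
    by (simp add: l_def inner_sum_right right_diff_distrib sum_subtractf)
  also have "\<dots> \<ge> \<mu>"
    using S(6) fw by (simp add: S(5) inner_commute)
  finally have "(\<Sum>z\<in>S. p z * (\<mu> - l z)) \<le> 0"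
    using S(4) by (simp add: right_diff_distrib sum_subtractf flip: sum_distrib_right)
  moreover have nn: "p z * (\<mu> - l z) \<ge> 0" if "z \<in> S" for z
    using S(3) l_le that by (simp add: mult_nonneg_nonneg)
  ultimately have "(\<Sum>z\<in>S. p z * (\<mu> - l z)) = 0"
    by (simp add: antisym sum_nonneg)
  then have tight: "p z = 0 \<or> l z = \<mu>" if "z \<in> S" for z
    using sum_nonneg_eq_0_iff[OF S(1) nn] that by auto
  define A where "A = {(u, y). u \<in> K \<and> y \<in> Kd \<and> y \<bullet> u - (f \<bullet> u) * (y \<bullet> w\<^sub>0) = \<mu>}"
  define D where "D = (\<lambda>(u, y). L ((f \<bullet> u) *\<^sub>R y)) ` A"
  let ?S = "{z \<in> S. p z \<noteq> 0}"
  have "L (fst z) \<in> D" if z: "z \<in> ?S" for z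
  proof -
    obtain u y where uy: "u \<in> K" "y \<in> Kd" "z = ((f \<bullet> u) *\<^sub>R y, y \<bullet> u)"
      using subsetD[OF S(2), of z] z by auto
    then have "(u, y) \<in> A" using tight[of z] z by (auto simp: A_def l_def inner_commute)
    then show ?thesis unfolding D_def using uy(3) by force
  qed
  moreover have "sum p ?S = sum p S"
    by (rule sum.mono_neutral_left[OF S(1)]) auto
  moreover have "convex (convex hull D)" by simp
  ultimately have "(\<Sum>z\<in>?S. p z *\<^sub>R L (fst z)) \<in> convex hull D"
    using S(1,3,4) by (intro convex_sum) (auto intro: hull_inc)
  moreover have "(\<Sum>z\<in>?S. p z *\<^sub>R L (fst z)) = (\<Sum>z\<in>S. p z *\<^sub>R L (fst z))"
    by (rule sum.mono_neutral_left[OF S(1)]) auto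
  moreover have "\<dots> = L (\<Sum>z\<in>S. p z *\<^sub>R fst z)"
    by (simp add: linear_sum[OF linL] linear_scale[OF linL])
  moreover have "\<dots> = 0" unfolding S(5) using fw by (simp add: L_def inner_commute)
  ultimately have "0 \<in> convex hull D" by simp
  moreover have "D \<subseteq> {x. w\<^sub>0 \<bullet> x = 0}" unfolding D_def using wL by auto
  moreover have "w\<^sub>0 \<noteq> 0" using fw by auto
  ultimately obtain I \<alpha> where I: "finite I" "I \<subseteq> D" "card I \<le> DIM('e)" "\<forall>z\<in>I. \<alpha> z > 0" "sum \<alpha> I = 1"
    "(\<Sum>z\<in>I. \<alpha> z *\<^sub>R z) = 0"
    by (rule caratheodory_in_hyperplane)
  have "\<forall>i\<in>I. \<exists>q. q \<in> A \<and> i = L ((f \<bullet> fst q) *\<^sub>R snd q)" using I(2) unfolding D_def by force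
  then obtain q where q: "\<And>i. i \<in> I \<Longrightarrow> q i \<in> A" "\<And>i. i \<in> I \<Longrightarrow> i = L ((f \<bullet> fst (q i)) *\<^sub>R snd (q i))"
    by metis
  define x where "x = (\<Sum>i\<in>I. (\<alpha> i * (f \<bullet> fst (q i))) *\<^sub>R snd (q i))"
  have "L x = (\<Sum>i\<in>I. \<alpha> i *\<^sub>R L ((f \<bullet> fst (q i)) *\<^sub>R snd (q i)))"
    by (simp add: x_def linear_sum[OF linL] linear_scale[OF linL])
  also have "\<dots> = (\<Sum>i\<in>I. \<alpha> i *\<^sub>R i)" by (rule sum.cong) (use q(2) in auto)
  finally have "x = (w\<^sub>0 \<bullet> x) *\<^sub>R f" using I(6) by (simp add: L_def)
  then have eq: "(\<Sum>i\<in>I. (\<alpha> i * (f \<bullet> fst (q i))) *\<^sub>R snd (q i)) = (w\<^sub>0 \<bullet> x) *\<^sub>R f"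
    by (simp add: x_def)
  have qA: "fst (q i) \<in> K" "snd (q i) \<in> Kd"
    "snd (q i) \<bullet> fst (q i) - (f \<bullet> fst (q i)) * (snd (q i) \<bullet> w\<^sub>0) = \<mu>" if "i \<in> I" for i
    using q(1)[OF that] by (auto simp: A_def case_prod_unfold)
  show ?thesis
    by (rule that[of I \<alpha> "\<lambda>i. fst (q i)" "\<lambda>i. snd (q i)" "w\<^sub>0 \<bullet> x"]) (use I qA eq in blast)+
qed

text \<open>
  After changing the sign of both members where necessary, every norming pair satisfies \<open>f \<bullet> x > 0\<close>, and
  the inequality for weights applies to the Gram matrix \<open>g j \<bullet> x i\<close>. The number \<open>f \<bullet> u i\<close> cannot
  vanish because \<open>\<mu> > 1\<close>, while values of \<open>y\<close> on \<open>K\<close> are at most \<open>1\<close>.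
\<close>

lemma extremal_system:
  fixes K Kd :: "'e::euclidean_space set"
  assumes n: "n = DIM('e)" "n \<ge> 3" and \<mu>: "\<mu> = 2 - 2 / real n"
    and K: "compact K" "K \<noteq> {}" "\<forall>u\<in>K. - u \<in> K" and Kd: "compact Kd" "Kd \<noteq> {}" "\<forall>y\<in>Kd. - y \<in> Kd"
    and polar: "\<forall>u\<in>K. \<forall>y\<in>Kd. y \<bullet> u \<le> 1"
    and fw: "f \<bullet> w\<^sub>0 = 1"
    and up: "\<And>u y. u \<in> K \<Longrightarrow> y \<in> Kd \<Longrightarrow> y \<bullet> u - (f \<bullet> u) * (y \<bullet> w\<^sub>0) \<le> \<mu>"
    and low: "\<forall>w c. f \<bullet> w = 1 \<longrightarrow> (\<forall>u\<in>K. \<forall>y\<in>Kd. y \<bullet> u - (f \<bullet> u) * (y \<bullet> w) \<le> c) \<longrightarrow> \<mu> \<le> c"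
  obtains I :: "'e set" and x g c where "finite I" "card I = n"
    "\<forall>i\<in>I. x i \<in> K" "\<forall>i\<in>I. g i \<in> Kd" "\<forall>i\<in>I. g i \<bullet> x i = 1"
    "\<forall>i\<in>I. \<forall>j\<in>I. i \<noteq> j \<longrightarrow> g j \<bullet> x i = -1" "c \<noteq> 0" "(\<Sum>i\<in>I. g i) = c *\<^sub>R f"
proof -
  obtain I :: "'e set" and \<alpha> u y c where I: "finite I" "card I \<le> DIM('e)"
    "\<forall>i\<in>I. \<alpha> i > 0" "sum \<alpha> I = 1" "\<forall>i\<in>I. u i \<in> K" "\<forall>i\<in>I. y i \<in> Kd"
    "\<forall>i\<in>I. y i \<bullet> u i - (f \<bullet> u i) * (y i \<bullet> w\<^sub>0) = \<mu>"
    "(\<Sum>i\<in>I. (\<alpha> i * (f \<bullet> u i)) *\<^sub>R y i) = c *\<^sub>R f"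
    by (rule saddle_point_few_pairs[OF K Kd(1,2) fw up low])
  have mu1: "\<mu> > 1" using n(2) by (simp add: \<mu> divide_less_eq)
  have fu: "f \<bullet> u i \<noteq> 0" if "i \<in> I" for i
  proof
    assume "f \<bullet> u i = 0"
    then have "y i \<bullet> u i = \<mu>" using I(7) that by auto
    moreover have "y i \<bullet> u i \<le> 1" using polar I(5,6) that by auto
    ultimately show False using mu1 by simp
  qed
  define x where "x i = sgn (f \<bullet> u i) *\<^sub>R u i" for i
  define g where "g i = sgn (f \<bullet> u i) *\<^sub>R y i" for i
  define h where "h i = f \<bullet> x i" for i
  have h_abs: "h i = \<bar>f \<bullet> u i\<bar>" for i by (simp add: h_def x_def abs_sgn mult.commute)
  have xK: "x i \<in> K" and gK: "g i \<in> Kd" if "i \<in> I" for i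
    using I(5,6) K(3) Kd(3) fu[OF that] that by (auto simp: x_def g_def sgn_if)
  define B where "B = (\<Sum>i\<in>I. \<alpha> i * h i)"
  have h0: "h i > 0" if "i \<in> I" for i using fu[OF that] by (simp add: h_abs)
  have "I \<noteq> {}" using I(4) by auto
  then have B: "B > 0" unfolding B_def using I(1,3) h0 by (intro sum_pos) auto
  define \<beta> where "\<beta> i = \<alpha> i * h i / B" for i
  have b0: "\<beta> i > 0" if "i \<in> I" for i using I(3) h0 B that by (simp add: \<beta>_def)
  have b1: "sum \<beta> I = 1" using B by (simp add: \<beta>_def B_def flip: sum_divide_distrib)
  define t where "t i = - (g i \<bullet> w\<^sub>0)" for i
  have diag: "g i \<bullet> x i + h i * t i = 2 - 2 / real n" if "i \<in> I" for i
  proof -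
    have "sgn (f \<bullet> u i) * sgn (f \<bullet> u i) = 1" using fu[OF that] by (simp add: sgn_if)
    then have "g i \<bullet> x i + h i * t i = y i \<bullet> u i - (f \<bullet> u i) * (y i \<bullet> w\<^sub>0)"
      by (simp add: g_def x_def h_def t_def)
    then show ?thesis using I(7) that \<mu> by simp
  qed
  have bnd: "\<bar>g j \<bullet> x i\<bar> \<le> 1" if "i \<in> I" "j \<in> I" for i j
  proof -
    have "g j \<bullet> x i \<le> 1" "g j \<bullet> (- x i) \<le> 1" using xK[OF that(1)] gK[OF that(2)] polar K(3) by blast+
    then show ?thesis by (simp add: abs_le_iff)
  qed
  define c' where "c' = c / B"
  have "\<beta> i *\<^sub>R g i = (1 / B) *\<^sub>R ((\<alpha> i * (f \<bullet> u i)) *\<^sub>R y i)" if "i \<in> I" for i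
    using fu[OF that] by (simp add: \<beta>_def g_def h_abs sgn_if)
  then have "(\<Sum>i\<in>I. \<beta> i *\<^sub>R g i) = (1 / B) *\<^sub>R (\<Sum>i\<in>I. (\<alpha> i * (f \<bullet> u i)) *\<^sub>R y i)"
    by (simp add: scaleR_right.sum)
  then have comb: "(\<Sum>i\<in>I. \<beta> i *\<^sub>R g i) = c' *\<^sub>R f"
    unfolding I(8) by (simp add: c'_def)
  define T where "T = (\<Sum>j\<in>I. \<beta> j * t j)"
  have "T = - ((\<Sum>i\<in>I. \<beta> i *\<^sub>R g i) \<bullet> w\<^sub>0)" by (simp add: T_def t_def inner_sum_left sum_negf)
  then have T: "c' = - T" unfolding comb using fw by simp
  have bal: "(\<Sum>j\<in>I. \<beta> j * (g j \<bullet> x i)) = - (T * h i)" for i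
  proof -
    have "(\<Sum>j\<in>I. \<beta> j * (g j \<bullet> x i)) = (\<Sum>j\<in>I. \<beta> j *\<^sub>R g j) \<bullet> x i" by (simp add: inner_sum_left)
    then show ?thesis unfolding comb T by (simp add: h_def)
  qed
  note E = extremal_weights[of n I \<beta> h "\<lambda>j i. g j \<bullet> x i" t T, OF n(2) I(1) _ b0 b1 h0 bnd diag T_def bal]
  have cI: "card I \<le> n" using I(2) n by simp
  show ?thesis
  proof (rule that[of I x g "- real n * T"])
    show "- real n * T \<noteq> 0" using E(2)[OF cI] n by simp
    have "(\<Sum>i\<in>I. \<beta> i *\<^sub>R g i) = (1 / real n) *\<^sub>R (\<Sum>i\<in>I. g i)"
      unfolding scaleR_right.sum by (rule sum.cong) (use E(3)[OF cI] in auto)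
    then have "(\<Sum>i\<in>I. g i) = real n *\<^sub>R (c' *\<^sub>R f)" using n unfolding comb[symmetric] by simp
    then show "(\<Sum>i\<in>I. g i) = (- real n * T) *\<^sub>R f" by (simp add: T)
    show "finite I" "card I = n" using I(1) E(1)[OF cI] by auto
    show "\<forall>i\<in>I. x i \<in> K" "\<forall>i\<in>I. g i \<in> Kd" using xK gK by auto
    show "\<forall>i\<in>I. g i \<bullet> x i = 1" using E(4)[OF cI] by blast
    show "\<forall>i\<in>I. \<forall>j\<in>I. i \<noteq> j \<longrightarrow> g j \<bullet> x i = -1" using E(5)[OF cI] by blast
  qed
qed

text \<open>
  The Gram matrix \<open>2 I - J\<close>, with \<open>J\<close> the all-ones matrix, has the eigenvalues \<open>2\<close> and \<open>2 - n\<close>. It is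
  singular exactly for \<open>n = 2\<close>.
\<close>

lemma span_UNIV_if_sign_matrix:
  fixes x g :: "'i \<Rightarrow> 'e::euclidean_space"
  assumes fin: "finite I" and card: "card I = DIM('e)" "DIM('e) \<noteq> 2"
    and one: "\<forall>i\<in>I. g i \<bullet> x i = 1" and neg: "\<forall>i\<in>I. \<forall>j\<in>I. i \<noteq> j \<longrightarrow> g j \<bullet> x i = -1"
  shows "span (x ` I) = UNIV"
proof -
  have inj: "inj_on x I"
  proof (rule inj_onI, rule ccontr)
    fix i j assume ij: "i \<in> I" "j \<in> I" "x i = x j" "i \<noteq> j"
    then have "g j \<bullet> x i = -1" using neg by blast
    moreover have "g j \<bullet> x j = 1" using one ij by blast
    ultimately show False using ij by simp
  qed
  have ind: "independent (x ` I)"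
  proof (rule independent_if_scalars_zero)
    fix c v assume sum0: "(\<Sum>v\<in>x ` I. c v *\<^sub>R v) = 0" and v: "v \<in> x ` I"
    define s where "s = (\<Sum>i\<in>I. c (x i))"
    have eq: "2 * c (x j) = s" if j: "j \<in> I" for j
    proof -
      have "0 = g j \<bullet> (\<Sum>v\<in>x ` I. c v *\<^sub>R v)" by (simp add: sum0)
      also have "\<dots> = (\<Sum>i\<in>I. c (x i) * (g j \<bullet> x i))"
        by (simp add: sum.reindex[OF inj] inner_sum_right)
      also have "\<dots> = (\<Sum>i\<in>I. (if i = j then 2 * c (x j) else 0) - c (x i))"
      proof (rule sum.cong[OF refl])
        fix i assume i: "i \<in> I"
        have "g j \<bullet> x i = (if i = j then 1 else -1)" using one neg i j by metis
        then show "c (x i) * (g j \<bullet> x i) = (if i = j then 2 * c (x j) else 0) - c (x i)" by simp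
      qed
      also have "\<dots> = 2 * c (x j) - s"
        using fin j by (simp add: sum_subtractf s_def)
      finally show ?thesis by simp
    qed
    have "2 * s = (\<Sum>i\<in>I. 2 * c (x i))" by (simp add: s_def sum_distrib_left)
    also have "\<dots> = real DIM('e) * s" using eq card by simp
    finally have "s = 0" using card(2) by (metis mult_cancel_right of_nat_eq_iff of_nat_numeral)
    then show "c v = 0" using eq v by auto
  qed (use fin in simp)
  have "dim (UNIV :: 'e set) \<le> card (x ` I)" using card card_image[OF inj] by simp
  then have "UNIV \<subseteq> span (x ` I)" using ind by (intro card_ge_dim_independent) auto
  then show ?thesis by auto
qed

section \<open>Projections in Euclidean coordinates\<close>

text \<open>
  A linear bijection with a Euclidean space moves the unit ball to the convex body \<open>K\<close> and identifies
  the dual unit ball with its polar body.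
\<close>

locale coordinates =
  fixes \<phi> :: "'e::euclidean_space \<Rightarrow> 'a::real_normed_vector"
  assumes lin: "linear \<phi>" and bij: "bij \<phi>"
begin

definition \<psi> :: "'a \<Rightarrow> 'e" where "\<psi> = inv \<phi>"

definition K :: "'e set" where "K = {u. norm (\<phi> u) \<le> 1}"

definition polar :: "'e set" where "polar = {y. \<forall>u\<in>K. y \<bullet> u \<le> 1}"

lemma phi_psi [simp]: "\<phi> (\<psi> x) = x" and psi_phi [simp]: "\<psi> (\<phi> u) = u"
  using bij by (simp_all add: \<psi>_def bij_is_surj surj_f_inv_f bij_is_inj)

lemmas phi_simps = linear_add[OF lin] linear_diff[OF lin] linear_scale[OF lin] linear_neg[OF lin] linear_0[OF lin]

lemma lin_psi: "linear \<psi>"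
  by (rule linearI) (metis phi_psi psi_phi phi_simps)+

lemma continuous_phi: "continuous_on A \<phi>"
  using lin linear_continuous_on linear_conv_bounded_linear by blast

lemma phi_bounded_above: obtains M where "M > 0" "\<And>u. norm (\<phi> u) \<le> M * norm u"
  using bounded_linear.pos_bounded[of \<phi>] lin by (metis linear_conv_bounded_linear mult.commute)

lemma phi_bounded_below: obtains m where "m > 0" "\<And>u. norm (\<phi> u) \<ge> m * norm u"
proof -
  obtain b :: 'e where b: "b \<in> Basis" by (meson nonempty_Basis all_not_in_conv)
  have "\<exists>x\<in>sphere 0 1. \<forall>y\<in>sphere (0::'e) 1. norm (\<phi> x) \<le> norm (\<phi> y)"
    by (rule continuous_attains_inf) (use b norm_Basis in \<open>auto intro!: continuous_on_norm continuous_phi\<close>)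
  then obtain x where x: "norm x = 1" "\<And>y. norm y = 1 \<Longrightarrow> norm (\<phi> x) \<le> norm (\<phi> y)" by auto
  have "\<phi> x \<noteq> 0" using x(1) by (metis linear_0[OF lin] norm_zero psi_phi zero_neq_one)
  moreover have "norm (\<phi> x) * norm u \<le> norm (\<phi> u)" for u
  proof (cases "u = 0")
    case False
    then have "norm (\<phi> x) \<le> norm (\<phi> ((1 / norm u) *\<^sub>R u))" by (intro x(2)) simp
    then show ?thesis using False by (simp add: phi_simps field_simps)
  qed (simp add: phi_simps)
  ultimately show ?thesis using that by (metis zero_less_norm_iff)
qed

lemma bounded_linear_psi: "bounded_linear \<psi>"
proof -
  obtain m where m: "m > 0" "\<And>u. norm (\<phi> u) \<ge> m * norm u" by (rule phi_bounded_below) blast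
  have "norm (\<psi> x) \<le> norm x * (1 / m)" for x
    using m(2)[of "\<psi> x"] m(1) by (simp add: field_simps)
  then show ?thesis using lin_psi
    by (intro bounded_linear_intro[of _ "1 / m"]) (auto simp: linear_add linear_scale)
qed

lemma zero_in_K: "0 \<in> K" by (simp add: K_def phi_simps)
lemma K_sym: "\<forall>u\<in>K. - u \<in> K" by (simp add: K_def phi_simps)
lemma zero_in_polar: "0 \<in> polar" by (simp add: polar_def)
lemma polar_sym: "\<forall>y\<in>polar. - y \<in> polar"
  using K_sym by (fastforce simp: polar_def)

lemma closed_K: "closed K"
  unfolding K_def by (intro closed_Collect_le continuous_intros continuous_phi)

lemma convex_K: "convex K"
proof -
  have "K = \<phi> -` cball 0 1" by (auto simp: K_def)
  then show ?thesis by (simp add: convex_linear_vimage lin)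
qed

lemma compact_K: "compact K"
proof -
  obtain m where m: "m > 0" "\<And>u. norm (\<phi> u) \<ge> m * norm u" by (rule phi_bounded_below) blast
  have "norm u \<le> 1 / m" if "u \<in> K" for u
    using m(2)[of u] that m(1) by (simp add: K_def field_simps)
  then have "bounded K" unfolding bounded_iff by blast
  then show ?thesis using closed_K compact_eq_bounded_closed by blast
qed

lemma polar_le_norm: "y \<in> polar \<Longrightarrow> y \<bullet> v \<le> norm (\<phi> v)"
proof (cases "v = 0")
  case False
  assume y: "y \<in> polar"
  have nz: "norm (\<phi> v) > 0" using False by (metis linear_0[OF lin] zero_less_norm_iff psi_phi)
  then have "(1 / norm (\<phi> v)) *\<^sub>R v \<in> K" by (simp add: K_def phi_simps)
  then have "y \<bullet> ((1 / norm (\<phi> v)) *\<^sub>R v) \<le> 1" using y by (auto simp: polar_def)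
  then show ?thesis using nz by (simp add: field_simps)
qed (simp add: phi_simps)

lemma compact_polar: "compact polar"
proof -
  have "polar = (\<Inter>u\<in>K. {y. y \<bullet> u \<le> 1})" by (auto simp: polar_def)
  moreover have "closed {y. y \<bullet> u \<le> 1}" for u :: 'e
    by (intro closed_Collect_le continuous_intros)
  ultimately have "closed polar" by auto
  obtain M where M: "M > 0" "\<And>u. norm (\<phi> u) \<le> M * norm u" by (rule phi_bounded_above) blast
  have "norm y \<le> M" if "y \<in> polar" for y
  proof (cases "y = 0")
    case False
    have "norm y * norm y \<le> norm (\<phi> y)"
      using polar_le_norm[OF that, of y] by (simp add: dot_square_norm power2_eq_square)
    also have "\<dots> \<le> M * norm y" by (rule M)
    finally show ?thesis using False by simp
  qed (use M in auto)
  then have "bounded polar" unfolding bounded_iff by blast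
  then show ?thesis using \<open>closed polar\<close> compact_eq_bounded_closed by blast
qed

text \<open>
  This is the bipolar theorem for \<open>K\<close>: a vector outside a dilate of the closed convex set \<open>K\<close> can be
  separated from it, and the separating functional, suitably scaled, belongs to the polar.
\<close>

lemma norm_le_if_polar_le:
  assumes "\<And>y. y \<in> polar \<Longrightarrow> y \<bullet> v \<le> c"
  shows "norm (\<phi> v) \<le> c"
proof (rule ccontr)
  assume "\<not> norm (\<phi> v) \<le> c"
  then obtain d where d: "c < d" "d < norm (\<phi> v)" using dense by (metis not_le)
  have "c \<ge> 0" using assms[OF zero_in_polar] by simp
  with d have d0: "d > 0" by simp
  have "(1 / d) *\<^sub>R v \<notin> K" using d d0 by (simp add: K_def phi_simps)
  then obtain a b where ab: "a \<bullet> ((1 / d) *\<^sub>R v) < b" "\<forall>x\<in>K. b < a \<bullet> x"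
    using separating_hyperplane_closed_point[OF convex_K closed_K] by blast
  then have b: "b < 0" using zero_in_K by force
  have "(1 / b) *\<^sub>R a \<in> polar" using ab(2) b by (auto simp: polar_def field_simps intro: less_imp_le)
  then have "((1 / b) *\<^sub>R a) \<bullet> v \<le> c" by (rule assms)
  moreover have "a \<bullet> v < b * d" using ab(1) d0 by (simp add: field_simps)
  then have "((1 / b) *\<^sub>R a) \<bullet> v > d" using b by (simp add: field_simps)
  ultimately show False using d by simp
qed

lemma hyperplane_functional:
  assumes "subspace Y" "dim Y = DIM('e) - 1"
  obtains f where "f \<noteq> 0" "Y = {x. f \<bullet> \<psi> x = 0}"
proof -
  let ?S = "\<psi> ` Y"
  have img: "\<phi> ` ?S = Y" by (simp add: image_image)
  have sub: "subspace ?S" using assms(1) lin_psi by (rule linear_subspace_image[rotated])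
  have "inj_on \<phi> (span ?S)" using bij bij_is_inj inj_on_subset by blast
  then have "dim ?S = DIM('e) - 1" using eucl.dim_image_eq[OF lin] img assms(2) by metis
  then obtain f where f: "f \<noteq> 0" "span ?S = {x. f \<bullet> x = 0}" by (rule lowdim_eq_hyperplane)
  then have S: "?S = {x. f \<bullet> x = 0}" using sub by (simp add: span_eq_iff[THEN iffD2])
  have "Y = {x. f \<bullet> \<psi> x = 0}"
  proof (intro set_eqI iffI)
    fix x assume "x \<in> {x. f \<bullet> \<psi> x = 0}"
    then have "\<psi> x \<in> ?S" unfolding S by simp
    then show "x \<in> Y" by (metis imageE phi_psi)
  qed (use S in auto)
  with f(1) show ?thesis by (rule that)
qed

lemma projection_along:
  assumes "f \<bullet> w = 1"
  shows "is_projection_onto (\<lambda>x. x - (f \<bullet> \<psi> x) *\<^sub>R \<phi> w) {x. f \<bullet> \<psi> x = 0}"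
  unfolding is_projection_onto_def
proof (intro conjI)
  show "bounded_linear (\<lambda>x. x - (f \<bullet> \<psi> x) *\<^sub>R \<phi> w)"
    by (intro bounded_linear_sub bounded_linear_ident bounded_linear_scaleR_const
        bounded_linear_compose[OF bounded_linear_inner_right bounded_linear_psi])
  show "range (\<lambda>x. x - (f \<bullet> \<psi> x) *\<^sub>R \<phi> w) \<subseteq> {x. f \<bullet> \<psi> x = 0}"
    using assms by (auto simp: linear_diff[OF lin_psi] linear_scale[OF lin_psi] inner_diff_right)
qed auto

lemma onorm_projection_along_le:
  assumes c: "\<And>u y. u \<in> K \<Longrightarrow> y \<in> polar \<Longrightarrow> y \<bullet> u - (f \<bullet> u) * (y \<bullet> w) \<le> c"
  shows "onorm (\<lambda>x. x - (f \<bullet> \<psi> x) *\<^sub>R \<phi> w) \<le> c"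
proof (rule onorm_bound)
  show "0 \<le> c" using c[OF zero_in_K zero_in_polar] by simp
  fix x
  show "norm (x - (f \<bullet> \<psi> x) *\<^sub>R \<phi> w) \<le> c * norm x"
  proof (cases "x = 0")
    case False
    define u where "u = (1 / norm x) *\<^sub>R \<psi> x"
    have x: "x = norm x *\<^sub>R \<phi> u" using False by (simp add: u_def phi_simps)
    have "u \<in> K" using False by (simp add: K_def u_def phi_simps)
    then have "norm (\<phi> (u - (f \<bullet> u) *\<^sub>R w)) \<le> c"
      using c by (intro norm_le_if_polar_le) (simp add: inner_diff_right)
    moreover have "x - (f \<bullet> \<psi> x) *\<^sub>R \<phi> w = norm x *\<^sub>R \<phi> (u - (f \<bullet> u) *\<^sub>R w)"
      using False by (simp add: u_def phi_simps scaleR_diff_right)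
    ultimately show ?thesis by (simp add: mult.commute[of c] mult_left_mono)
  qed (simp add: linear_0[OF lin_psi])
qed

text \<open>
  Every projection onto the kernel of \<open>f\<close> is a projection along some \<open>w\<close>: it fixes the kernel, so it is
  determined by its value at one vector \<open>x0\<close> with \<open>f \<bullet> x0 = 1\<close>.
\<close>

lemma projection_direction:
  assumes P: "is_projection_onto P {x. f \<bullet> \<psi> x = 0}" and f: "f \<noteq> 0"
  obtains w where "f \<bullet> w = 1"
    "\<forall>u\<in>K. \<forall>y\<in>polar. y \<bullet> u - (f \<bullet> u) * (y \<bullet> w) \<le> onorm P"
proof -
  have bl: "bounded_linear P" and ran: "f \<bullet> \<psi> (P x) = 0" and fixed: "f \<bullet> \<psi> x = 0 \<Longrightarrow> P x = x" for x
    using P by (auto simp: is_projection_onto_def)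
  define x0 where "x0 = (1 / (f \<bullet> f)) *\<^sub>R f"
  have fx0: "f \<bullet> x0 = 1" using f by (simp add: x0_def)
  define w where "w = x0 - \<psi> (P (\<phi> x0))"
  have P_eq: "\<psi> (P (\<phi> u)) = u - (f \<bullet> u) *\<^sub>R w" for u
  proof -
    have "P (\<phi> (u - (f \<bullet> u) *\<^sub>R x0)) = \<phi> (u - (f \<bullet> u) *\<^sub>R x0)"
      using fx0 by (intro fixed) (simp add: inner_diff_right)
    then have "P (\<phi> u) = \<phi> (u - (f \<bullet> u) *\<^sub>R x0) + (f \<bullet> u) *\<^sub>R P (\<phi> x0)"
      using bl by (simp add: phi_simps bounded_linear.linear linear_diff linear_scale diff_eq_eq)
    then show ?thesis
      by (simp add: w_def linear_add[OF lin_psi] linear_scale[OF lin_psi] scaleR_diff_right)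
  qed
  show ?thesis
  proof (rule that[of w])
    show "f \<bullet> w = 1" using fx0 ran by (simp add: w_def inner_diff_right)
    show "\<forall>u\<in>K. \<forall>y\<in>polar. y \<bullet> u - (f \<bullet> u) * (y \<bullet> w) \<le> onorm P"
    proof (intro ballI)
      fix u y assume u: "u \<in> K" and y: "y \<in> polar"
      have "y \<bullet> u - (f \<bullet> u) * (y \<bullet> w) = y \<bullet> \<psi> (P (\<phi> u))" by (simp add: P_eq inner_diff_right)
      also have "\<dots> \<le> norm (P (\<phi> u))" using polar_le_norm[OF y, of "\<psi> (P (\<phi> u))"] by simp
      also have "\<dots> \<le> onorm P * norm (\<phi> u)" by (rule onorm[OF bl])
      also have "\<dots> \<le> onorm P" using u onorm_pos_le[OF bl] by (simp add: K_def mult_left_le)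
      finally show "y \<bullet> u - (f \<bullet> u) * (y \<bullet> w) \<le> onorm P" .
    qed
  qed
qed

lemma rel_projection_const_le:
  assumes "f \<bullet> w = 1" "\<And>u y. u \<in> K \<Longrightarrow> y \<in> polar \<Longrightarrow> y \<bullet> u - (f \<bullet> u) * (y \<bullet> w) \<le> c"
  shows "rel_projection_const {x. f \<bullet> \<psi> x = 0} \<le> c"
proof -
  have "rel_projection_const {x. f \<bullet> \<psi> x = 0} \<le> onorm (\<lambda>x. x - (f \<bullet> \<psi> x) *\<^sub>R \<phi> w)"
    unfolding rel_projection_const_def
  proof (rule cInf_lower)
    show "bdd_below {onorm P |P. is_projection_onto P {x. f \<bullet> \<psi> x = 0}}"
      by (rule bdd_belowI[of _ 0]) (auto simp: is_projection_onto_def intro: onorm_pos_le)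
  qed (use projection_along[OF assms(1)] in blast)
  also have "\<dots> \<le> c" using assms(2) by (rule onorm_projection_along_le)
  finally show ?thesis .
qed

text \<open>
  Evaluating the inequalities at one \<open>u\<close> with \<open>f \<bullet> u > 0\<close>, and at \<open>- u\<close>, bounds every functional of
  the polar at \<open>w\<close>.
\<close>

lemma compact_directions:
  assumes "f \<noteq> 0"
  shows "compact {w. f \<bullet> w = 1 \<and> (\<forall>u\<in>K. \<forall>y\<in>polar. y \<bullet> u - (f \<bullet> u) * (y \<bullet> w) \<le> c)}" (is "compact ?F")
proof -
  have "?F = {w. f \<bullet> w = 1} \<inter> (\<Inter>u\<in>K. \<Inter>y\<in>polar. {w. y \<bullet> u - (f \<bullet> u) * (y \<bullet> w) \<le> c})" by auto
  moreover have "closed \<dots>"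
    by (intro closed_Int closed_INT ballI closed_Collect_le closed_Collect_eq continuous_intros)
  ultimately have "closed ?F" by simp
  define u where "u = (1 / norm (\<phi> f)) *\<^sub>R f"
  have nf: "norm (\<phi> f) > 0" using assms by (metis linear_0[OF lin] zero_less_norm_iff psi_phi)
  then have u: "u \<in> K" "- u \<in> K" by (simp_all add: u_def K_def phi_simps)
  have fu: "f \<bullet> u > 0" using nf assms by (simp add: u_def)
  obtain m where m: "m > 0" "\<And>u. norm (\<phi> u) \<ge> m * norm u" by (rule phi_bounded_below) blast
  have "norm w \<le> (c + 1) / (f \<bullet> u) / m" if w: "w \<in> ?F" for w
  proof -
    have "norm (\<phi> w) \<le> (c + 1) / (f \<bullet> u)"
    proof (rule norm_le_if_polar_le)
      fix y assume y: "y \<in> polar"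
      then have "y \<bullet> u \<le> 1" using u by (simp add: polar_def)
      moreover have "y \<bullet> (- u) - (f \<bullet> (- u)) * (y \<bullet> w) \<le> c" using w u y by blast
      ultimately show "y \<bullet> w \<le> (c + 1) / (f \<bullet> u)" using fu by (simp add: field_simps)
    qed
    then have "m * norm w \<le> (c + 1) / (f \<bullet> u)" using m(2)[of w] by simp
    then show ?thesis using m(1) by (simp only: pos_le_divide_eq mult.commute)
  qed
  then have "bounded ?F" unfolding bounded_iff by blast
  then show ?thesis using \<open>closed ?F\<close> compact_eq_bounded_closed by blast
qed

text \<open>
  The infimum of the norms of the projections is attained: the sets of directions whose projections have norm
  at most \<open>l + 1 / (k + 1)\<close> are nonempty, compact and nested.
\<close>

lemma minimal_projection:
  assumes f: "f \<noteq> 0"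
  obtains w where "f \<bullet> w = 1"
    "\<forall>u\<in>K. \<forall>y\<in>polar. y \<bullet> u - (f \<bullet> u) * (y \<bullet> w) \<le> rel_projection_const {x. f \<bullet> \<psi> x = 0}"
proof -
  let ?R = "{onorm P |P. is_projection_onto P {x. f \<bullet> \<psi> x = 0}}"
  define l where "l = rel_projection_const {x. f \<bullet> \<psi> x = 0}"
  define F where "F k = {w. f \<bullet> w = 1 \<and> (\<forall>u\<in>K. \<forall>y\<in>polar. y \<bullet> u - (f \<bullet> u) * (y \<bullet> w) \<le> l + 1 / real (Suc k))}" for k
  have "f \<bullet> ((1 / (f \<bullet> f)) *\<^sub>R f) = 1" using f by simp
  then have ne: "?R \<noteq> {}" using projection_along by blast
  have "F k \<noteq> {}" for k
  proof -
    have "Inf ?R < l + 1 / real (Suc k)" by (simp add: l_def rel_projection_const_def)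
    then obtain P where P: "is_projection_onto P {x. f \<bullet> \<psi> x = 0}" "onorm P < l + 1 / real (Suc k)"
      using cInf_lessD[OF ne] by blast
    obtain w where "f \<bullet> w = 1" "\<forall>u\<in>K. \<forall>y\<in>polar. y \<bullet> u - (f \<bullet> u) * (y \<bullet> w) \<le> onorm P"
      by (rule projection_direction[OF P(1) f])
    then have "w \<in> F k" using P(2) unfolding F_def by fastforce
    then show ?thesis by blast
  qed
  moreover have "compact (F k)" for k unfolding F_def by (rule compact_directions[OF f])
  moreover have "F k \<subseteq> F j" if "j \<le> k" for j k
  proof -
    have "1 / real (Suc k) \<le> 1 / real (Suc j)" using that by (simp add: frac_le)
    then show ?thesis unfolding F_def by fastforce
  qed
  ultimately have "\<Inter> (range F) \<noteq> {}" by (intro compact_nest)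
  then obtain w where w: "\<And>k. w \<in> F k" by blast
  show ?thesis
  proof (rule that[of w])
    show "f \<bullet> w = 1" using w[of 0] by (simp add: F_def)
    have "y \<bullet> u - (f \<bullet> u) * (y \<bullet> w) \<le> l" if uy: "u \<in> K" "y \<in> polar" for u y
    proof (rule field_le_epsilon)
      fix e :: real assume "e > 0"
      then obtain k where "1 / real (Suc k) < e" using nat_approx_posE by blast
      then show "y \<bullet> u - (f \<bullet> u) * (y \<bullet> w) \<le> l + e" using w[of k] uy unfolding F_def by fastforce
    qed
    then show "\<forall>u\<in>K. \<forall>y\<in>polar. y \<bullet> u - (f \<bullet> u) * (y \<bullet> w) \<le> rel_projection_const {x. f \<bullet> \<psi> x = 0}"
      by (simp add: l_def)
  qed
qed

end

context coordinates
begin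

lemma extremal_functionals:
  assumes n: "n = DIM('e)" "n \<ge> 3" and Y: "subspace Y" "dim Y = n - 1"
    and maximal: "rel_projection_const Y = 2 - 2 / real n"
  obtains I :: "'e set" and x g where "finite I" "card I = n"
    "\<forall>i\<in>I. bounded_linear (g i)" "\<forall>i\<in>I. \<forall>v. norm v \<le> 1 \<longrightarrow> g i v \<le> 1"
    "\<forall>i\<in>I. norm (x i) \<le> 1" "\<forall>i\<in>I. g i (x i) = 1"
    "\<forall>i\<in>I. \<forall>j\<in>I. i \<noteq> j \<longrightarrow> g j (x i) = -1"
    "span (x ` I) = (UNIV :: 'a set)" "Y = {v. (\<Sum>i\<in>I. g i v) = (0::real)}"
proof -
  have dimY: "dim Y = DIM('e) - 1" using Y(2) n(1) by simp
  obtain f where f: "f \<noteq> 0" "Y = {x. f \<bullet> \<psi> x = 0}"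
    by (rule hyperplane_functional[OF Y(1) dimY])
  note maximal = maximal[unfolded f(2)]
  obtain w where w: "f \<bullet> w = 1"
    "\<forall>u\<in>K. \<forall>y\<in>polar. y \<bullet> u - (f \<bullet> u) * (y \<bullet> w) \<le> rel_projection_const {x. f \<bullet> \<psi> x = 0}"
    by (rule minimal_projection[OF f(1)])
  have up: "y \<bullet> u - (f \<bullet> u) * (y \<bullet> w) \<le> 2 - 2 / real n" if "u \<in> K" "y \<in> polar" for u y
    using w(2) that unfolding maximal by blast
  have low: "\<forall>w c. f \<bullet> w = 1 \<longrightarrow> (\<forall>u\<in>K. \<forall>y\<in>polar. y \<bullet> u - (f \<bullet> u) * (y \<bullet> w) \<le> c) \<longrightarrow> 2 - 2 / real n \<le> c"
    unfolding maximal[symmetric] by (blast intro: rel_projection_const_le)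
  have ne: "K \<noteq> {}" "polar \<noteq> {}" using zero_in_K zero_in_polar by auto
  have pol: "\<forall>u\<in>K. \<forall>y\<in>polar. y \<bullet> u \<le> 1" by (simp add: polar_def)
  obtain I :: "'e set" and x g c where I: "finite I" "card I = n"
    "\<forall>i\<in>I. x i \<in> K" "\<forall>i\<in>I. g i \<in> polar" "\<forall>i\<in>I. g i \<bullet> x i = 1"
    "\<forall>i\<in>I. \<forall>j\<in>I. i \<noteq> j \<longrightarrow> g j \<bullet> x i = -1" "c \<noteq> 0" "(\<Sum>i\<in>I. g i) = c *\<^sub>R f"
    by (rule extremal_system[OF n refl compact_K ne(1) K_sym compact_polar ne(2) polar_sym pol w(1) up low])
  show ?thesis
  proof (rule that[of I "\<lambda>i v. g i \<bullet> \<psi> v" "\<lambda>i. \<phi> (x i)"])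
    show "\<forall>i\<in>I. bounded_linear (\<lambda>v. g i \<bullet> \<psi> v)"
      by (intro ballI bounded_linear_compose[OF bounded_linear_inner_right bounded_linear_psi])
    show "\<forall>i\<in>I. \<forall>v. norm v \<le> 1 \<longrightarrow> g i \<bullet> \<psi> v \<le> 1"
      using I(4) by (simp add: polar_def K_def)
    have "span (x ` I) = UNIV"
      using span_UNIV_if_sign_matrix[OF I(1) _ _ I(5,6)] I(2) n by simp
    then have "span (\<phi> ` x ` I) = range \<phi>" using linear_span_image[OF lin] by simp
    then show "span ((\<lambda>i. \<phi> (x i)) ` I) = (UNIV :: 'a set)"
      using bij by (simp add: image_image bij_is_surj)
    have "(\<Sum>i\<in>I. g i \<bullet> \<psi> v) = c * (f \<bullet> \<psi> v)" for v
      using I(8) by (metis inner_scaleR_left inner_sum_left)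
    then show "Y = {v. (\<Sum>i\<in>I. g i \<bullet> \<psi> v) = 0}" using f(2) I(7) by simp
    show "finite I" "card I = n" using I(1,2) .
    show "\<forall>i\<in>I. norm (\<phi> (x i)) \<le> 1" using I(3) by (simp add: K_def)
    show "\<forall>i\<in>I. g i \<bullet> \<psi> (\<phi> (x i)) = 1" using I(5) unfolding psi_phi .
    show "\<forall>i\<in>I. \<forall>j\<in>I. i \<noteq> j \<longrightarrow> g j \<bullet> \<psi> (\<phi> (x i)) = -1" using I(6) unfolding psi_phi .
  qed
qed

end

section \<open>A Euclidean space of matching dimension\<close>

definition std_basis :: "'a::real_vector set" where
  "std_basis = (SOME B. independent B \<and> span B = (UNIV::'a set))"

text \<open>
  Indexing Euclidean coordinates by the vectors of a basis of \<open>'a\<close> turns every nonzero finite-dimensional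
  type \<open>'a\<close> into a linear copy of the Euclidean space \<open>real ^ 'a basis_index\<close>, even though the dimension
  is known only through an assumption. In the remaining cases the one-element index set is a placeholder
  that keeps the type nonempty and finite.
\<close>

typedef (overloaded) 'a basis_index =
  "if finite (std_basis :: 'a::real_vector set) \<and> (std_basis :: 'a set) \<noteq> {} then std_basis else {0 :: 'a}"
  by (cases "(std_basis :: 'a set) = {}") auto

lemma std_basis: "independent (std_basis :: 'a::real_vector set)" "span std_basis = (UNIV :: 'a set)"
proof -
  have "\<exists>B. independent B \<and> span B = (UNIV :: 'a set)"
    by (meson independent_extend_basis independent_empty span_extend_basis)
  from someI_ex[OF this] show "independent (std_basis :: 'a::real_vector set)" "span std_basis = (UNIV :: 'a set)"
    unfolding std_basis_def by auto
qed

instance basis_index :: (real_vector) finite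
proof
  have "(UNIV :: 'a basis_index set) = Abs_basis_index ` (if finite (std_basis :: 'a::real_vector set) \<and> (std_basis :: 'a set) \<noteq> {} then std_basis else {0 :: 'a})"
    by (metis type_definition.Abs_image type_definition_basis_index)
  then show "finite (UNIV :: 'a basis_index set)"
    by (metis finite.emptyI finite_imageI finite_insert)
qed

lemma euclidean_coordinates:
  assumes "dim (UNIV :: 'a::real_vector set) > 0"
  shows "\<exists>\<phi> :: real ^ 'a basis_index \<Rightarrow> 'a. linear \<phi> \<and> bij \<phi>"
proof -
  let ?B = "std_basis :: 'a set"
  have d: "card ?B = dim (UNIV :: 'a set)"
    using std_basis dim_eq_card by (metis span_UNIV)
  have fB: "finite ?B" and ne: "?B \<noteq> {}"
    using d assms by (auto intro: card_ge_0_finite)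
  have R: "range (Rep_basis_index :: 'a basis_index \<Rightarrow> 'a) = ?B"
    using type_definition.Rep_range[OF type_definition_basis_index[where 'a='a]] fB ne by simp
  have inj: "inj (Rep_basis_index :: 'a basis_index \<Rightarrow> 'a)"
    by (rule injI) (simp add: Rep_basis_index_inject)
  define \<phi> :: "real ^ 'a basis_index \<Rightarrow> 'a" where "\<phi> v = (\<Sum>i\<in>UNIV. v $ i *\<^sub>R Rep_basis_index i)" for v
  have eq: "(\<Sum>i\<in>UNIV. c (Rep_basis_index i) *\<^sub>R Rep_basis_index i) = (\<Sum>b\<in>?B. c b *\<^sub>R b)" for c :: "'a \<Rightarrow> real"
    using sum.reindex[OF inj, of "\<lambda>b. c b *\<^sub>R b"] R by simp
  have lin: "linear \<phi>"
    by (rule linearI) (simp_all add: \<phi>_def scaleR_add_left sum.distrib scaleR_sum_right)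
  have "inj \<phi>"
  proof (subst linear_injective_0[OF lin], intro allI impI)
    fix v assume v0: "\<phi> v = 0"
    define c where "c b = v $ (inv Rep_basis_index b)" for b :: 'a
    have c: "c (Rep_basis_index i) = v $ i" for i
      by (simp add: c_def inj)
    have "(\<Sum>b\<in>?B. c b *\<^sub>R b) = 0"
      using v0 eq[of c] by (simp add: \<phi>_def c)
    then have "\<forall>b\<in>?B. c b = 0"
      using std_basis(1) fB independent_explicit_finite_subsets by blast
    then have "v $ i = 0" for i
      using c[of i] R by (metis rangeI)
    then show "v = 0" by (simp add: vec_eq_iff)
  qed
  moreover have "surj \<phi>"
  proof -
    have "\<exists>v. x = \<phi> v" for x
    proof -
      have "x \<in> span ?B" using std_basis(2) by auto
      then obtain c where "x = (\<Sum>b\<in>?B. c b *\<^sub>R b)"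
        unfolding span_finite[OF fB] by auto
      then have "x = \<phi> (\<chi> i. c (Rep_basis_index i))"
        by (simp add: \<phi>_def eq)
      then show ?thesis by blast
    qed
    then show ?thesis by (auto simp: surj_def)
  qed
  ultimately show ?thesis using lin by (auto simp: bij_def)
qed

section \<open>Hyperplanes determined by facets\<close>

text \<open>
  A face contained in an affine subspace of dimension \<open>n - 2\<close> spans a linear subspace of dimension at most
  \<open>n - 1\<close>.
\<close>

lemma is_facet_if_spanning:
  fixes g :: "'a::real_normed_vector \<Rightarrow> real"
  assumes dim: "dim (UNIV :: 'a set) \<ge> 3" and g: "bounded_linear g" "\<And>v. v \<in> C \<Longrightarrow> g v \<le> 1"
    and span: "span {v \<in> C. g v = 1} = UNIV"
  shows "is_facet C {v \<in> C. g v = 1}"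
proof -
  let ?F = "{v \<in> C. g v = 1}"
  have neF: "?F \<noteq> {}"
  proof
    assume "?F = {}"
    then have "(UNIV :: 'a set) \<subseteq> span {}" using span by (simp only: order_refl)
    then have "dim (UNIV :: 'a set) \<le> card ({} :: 'a set)" by (rule dim_le_card) simp
    then show False using dim by simp
  qed
  have "is_face C ?F"
    unfolding is_face_def supporting_hyperplane_def
  proof (intro exI conjI)
    show "bounded_linear g" by (rule g)
    show "g \<noteq> (\<lambda>x. 0)"
    proof
      assume "g = (\<lambda>x. 0)"
      then show False using neF by simp
    qed
    show "{x. g x = 1} = {x. g x = 1}" ..
    show "\<forall>x\<in>C. g x \<le> 1" using g(2) by blast
    show "C \<inter> {x. g x = 1} \<noteq> {}" using neF by blast
    show "?F = C \<inter> {x. g x = 1}" by blast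
  qed
  moreover have False if V: "subspace V" "dim V = dim (UNIV :: 'a set) - 2" and sub: "?F \<subseteq> (\<lambda>v. a + v) ` V" for a V
  proof -
    obtain B where B: "B \<subseteq> V" "independent B" "V \<subseteq> span B" "card B = dim V"
      by (rule basis_exists)
    have finB: "finite B" using B(4) V(2) dim by (intro card_ge_0_finite) simp
    have "?F \<subseteq> span (insert a B)"
    proof
      fix x assume "x \<in> ?F"
      then obtain v where "v \<in> V" "x = a + v" using sub by auto
      moreover have "v \<in> span (insert a B)"
        using \<open>v \<in> V\<close> B(3) span_mono[OF subset_insertI] by blast
      ultimately show "x \<in> span (insert a B)" by (simp add: span_add span_base)
    qed
    then have "span ?F \<subseteq> span (insert a B)" by (intro span_minimal subspace_span)
    then have "UNIV \<subseteq> span (insert a B)" unfolding span .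
    then have "dim (UNIV :: 'a set) \<le> card (insert a B)" using finB by (intro dim_le_card) auto
    also have "\<dots> \<le> card B + 1" by (simp add: finB card_insert_if)
    finally show False using B(4) V(2) dim by simp
  qed
  ultimately show ?thesis unfolding is_facet_def by blast
qed

text \<open>
  A face that spans the space determines the functional \<open>h F\<close> whose value on it is \<open>1\<close>. Hence a set of
  such faces determines the kernel \<open>Y\<close> of the sum of these functionals. Only this uniqueness turns the
  choice of facets for every \<open>Y\<close> into an injection.
\<close>

definition hyperplane_of_facets :: "'a::real_normed_vector set set \<Rightarrow> 'a set \<Rightarrow> bool" where
  "hyperplane_of_facets S Y \<longleftrightarrow> (\<exists>h. (\<forall>F\<in>S. linear (h F) \<and> (\<forall>x\<in>F. h F x = 1) \<and> span F = UNIV) \<and>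
     Y = {v. (\<Sum>F\<in>S. h F v) = (0::real)})"

lemma hyperplane_of_facets_unique:
  assumes "hyperplane_of_facets S Y" "hyperplane_of_facets S Y'"
  shows "Y = Y'"
proof -
  obtain h h' where h: "\<forall>F\<in>S. linear (h F) \<and> (\<forall>x\<in>F. h F x = 1) \<and> span F = UNIV" "Y = {v. (\<Sum>F\<in>S. h F v) = (0::real)}"
    and h': "\<forall>F\<in>S. linear (h' F) \<and> (\<forall>x\<in>F. h' F x = 1) \<and> span F = UNIV" "Y' = {v. (\<Sum>F\<in>S. h' F v) = (0::real)}"
    using assms unfolding hyperplane_of_facets_def by blast
  have "h F v = h' F v" if "F \<in> S" for F v
    by (rule linear_eq_on_span[of "h F" "h' F" F]) (use h(1) h'(1) that in auto)
  then show ?thesis using h(2) h'(2) by simp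
qed

text \<open>
  Each functional \<open>g i\<close> of the extremal system takes the value \<open>1\<close> at \<open>x i\<close> and at \<open>- x j\<close> for
  \<open>j \<noteq> i\<close>. These are points of the unit ball that span the space, so \<open>g i\<close> supports a facet.
\<close>

lemma maximal_hyperplane_of_facets:
  fixes Y :: "'a::real_normed_vector set"
  assumes n: "n \<ge> 3" "dim (UNIV :: 'a set) = n" and Y: "subspace Y" "dim Y = n - 1"
    and maximal: "rel_projection_const Y = 2 - 2 / real n"
  obtains S where "S \<in> nsets {F. is_facet (cball 0 1) F} n" "hyperplane_of_facets S Y"
proof -
  obtain \<phi> :: "real ^ 'a basis_index \<Rightarrow> 'a" where phi: "linear \<phi>" "bij \<phi>"
    using euclidean_coordinates n by (metis gr0I not_numeral_le_zero)
  interpret coordinates \<phi> by (rule coordinates.intro[OF phi])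
  have "dim (range \<phi>) = dim (UNIV :: (real ^ 'a basis_index) set)"
    using bij by (intro eucl.dim_image_eq[OF lin]) (auto simp: bij_is_inj)
  then have DIM: "n = DIM(real ^ 'a basis_index)"
    using n(2) bij by (simp add: bij_is_surj)
  obtain I :: "(real ^ 'a basis_index) set" and x g where I: "finite I" "card I = n"
    "\<forall>i\<in>I. bounded_linear (g i)" "\<forall>i\<in>I. \<forall>v. norm v \<le> 1 \<longrightarrow> g i v \<le> 1"
    "\<forall>i\<in>I. norm (x i) \<le> 1" "\<forall>i\<in>I. g i (x i) = 1"
    "\<forall>i\<in>I. \<forall>j\<in>I. i \<noteq> j \<longrightarrow> g j (x i) = -1"
    "span (x ` I) = (UNIV :: 'a set)" "Y = {v. (\<Sum>i\<in>I. g i v) = (0::real)}"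
    by (rule extremal_functionals[OF DIM n(1) Y maximal])
  define F where "F i = {v \<in> cball 0 1. g i v = 1}" for i
  have spanF: "span (F i) = UNIV" if i: "i \<in> I" for i
  proof -
    have "x j \<in> span (F i)" if j: "j \<in> I" for j
    proof (cases "j = i")
      case True
      then show ?thesis using I(5,6) j by (intro span_base) (simp add: F_def)
    next
      case False
      have "linear (g i)" using I(3) i bounded_linear.linear by blast
      then have "- x j \<in> F i" using I(5,7) i j False by (simp add: F_def linear_neg)
      then show ?thesis using span_base span_neg by (metis minus_minus)
    qed
    then have "span (x ` I) \<subseteq> span (F i)" by (intro span_minimal) auto
    then show ?thesis using I(8) by auto
  qed
  have facet: "is_facet (cball 0 1) (F i)" if "i \<in> I" for i
    unfolding F_def
    by (rule is_facet_if_spanning) (use n I(3,4) spanF[OF that] that in \<open>auto simp: F_def\<close>)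
  have inj: "inj_on F I"
  proof (rule inj_onI, rule ccontr)
    fix i j assume ij: "i \<in> I" "j \<in> I" "F i = F j" "i \<noteq> j"
    then have "x i \<in> F j" using I(5,6) unfolding ij(3)[symmetric] by (simp add: F_def)
    then show False using I(7) ij by (simp add: F_def)
  qed
  show ?thesis
  proof (rule that[of "F ` I"])
    show "F ` I \<in> nsets {F. is_facet (cball 0 1) F} n"
      using facet I(1,2) card_image[OF inj] by (auto simp: nsets_def)
    show "hyperplane_of_facets (F ` I) Y"
      unfolding hyperplane_of_facets_def
    proof (intro exI[of _ "\<lambda>E. g (inv_into I F E)"] conjI ballI)
      fix E assume "E \<in> F ` I"
      then obtain i where i: "i \<in> I" "E = F i" by auto
      then have inv: "inv_into I F E = i" using inj by simp
      show "linear (g (inv_into I F E))" using I(3) i unfolding inv by (simp add: bounded_linear.linear)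
      show "span E = UNIV" using spanF i by simp
      show "g (inv_into I F E) v = 1" if "v \<in> E" for v using that i(2) unfolding inv by (simp add: F_def)
    next
      show "Y = {v. (\<Sum>E\<in>F ` I. g (inv_into I F E) v) = 0}"
        using I(9) by (simp add: sum.reindex[OF inj] inj)
    qed
  qed
qed

theorem theorem2p7:
  fixes n :: nat
  assumes "n \<ge> 3"
    and "dim (UNIV :: 'a::real_normed_vector set) = n"
  shows "{Y :: 'a set. subspace Y \<and> dim Y = n - 1 \<and> rel_projection_const Y = 2 - 2 / real n}
           \<lesssim> nsets {F. is_facet (cball (0::'a) 1) F} n"
proof -
  let ?M = "{Y :: 'a set. subspace Y \<and> dim Y = n - 1 \<and> rel_projection_const Y = 2 - 2 / real n}"
  let ?N = "nsets {F. is_facet (cball (0::'a) 1) F} n"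
  have "\<forall>Y\<in>?M. \<exists>S\<in>?N. hyperplane_of_facets S Y"
  proof
    fix Y assume "Y \<in> ?M"
    then have Y: "subspace Y" "dim Y = n - 1" "rel_projection_const Y = 2 - 2 / real n" by simp_all
    obtain S where "S \<in> ?N" "hyperplane_of_facets S Y"
      by (rule maximal_hyperplane_of_facets[OF assms Y])
    then show "\<exists>S\<in>?N. hyperplane_of_facets S Y" by (rule bexI[rotated])
  qed
  from bchoice[OF this[unfolded Bex_def]] obtain S
    where S: "\<forall>Y\<in>?M. S Y \<in> ?N \<and> hyperplane_of_facets (S Y) Y" ..
  have "inj_on S ?M"
  proof (rule inj_onI)
    fix Y Y' assume "Y \<in> ?M" "Y' \<in> ?M" and eq: "S Y = S Y'"
    then have "hyperplane_of_facets (S Y) Y" "hyperplane_of_facets (S Y) Y'"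
      using bspec[OF S, of Y] bspec[OF S, of Y'] by (simp_all only:)
    then show "Y = Y'" by (rule hyperplane_of_facets_unique)
  qed
  moreover have "S ` ?M \<subseteq> ?N"
  proof (rule image_subsetI)
    fix Y assume "Y \<in> ?M"
    from bspec[OF S this] show "S Y \<in> ?N" ..
  qed
  ultimately show ?thesis unfolding lepoll_def by (intro exI conjI)
qed

end
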